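(* Consider $K$ hash tables, each with $2^t$ buckets addressed by $\{0,1\}^t$. There is a sampling scheme consisting of a data structure and a sampling algorithm such that: - the data structure (the counts matrices $M^k_i$, for every table $k$ and address $i$) can be precomputed in time $O(Kt^32^t)$; - given any table $k$, any address $i\in\{0,1\}^t$ and any $d\in\{0,\dots,t\}$ such that table $k$ has at least one element in buckets at Hamming distance $d$ from $i$, the algorithm generates, in time $O(t)$, an element drawn uniformly at random from the elements of table $k$ stored in buckets at Hamming distance $d$ from $i$.
   Context: For table $k$ and address $i$, the counts matrix $M^k_i\in\mathbb{Z}^{(t+1)\times(t+1)}$ has entry $M^k_i[s,a]$ equal to the number of elements of table $k$ stored in buckets whose addresses are at Hamming distance $s$ from $i$ and agree with $i$ on the first $a$ bits. Running times assume unit-cost arithmetic, a biased coin flip in constant time, and constant-time uniform selection of an element within a given bucket. *)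

theory Defs
  imports "HOL-Probability.Probability"
begin

definition addresses :: "nat \<Rightarrow> bool list set" where
  "addresses t = {i. length i = t}"

definition hamming :: "bool list \<Rightarrow> bool list \<Rightarrow> nat" where
  "hamming i j = card {r. r < length i \<and> i ! r \<noteq> j ! r}"

text \<open>\<open>B k j\<close> is the bucket of table \<open>k < K\<close> with address \<open>j\<close>. An element of a table is
  stored in one bucket only, so that elements at different addresses are different.\<close>

definition hash_tables :: "nat \<Rightarrow> nat \<Rightarrow> (nat \<Rightarrow> bool list \<Rightarrow> 'e set) \<Rightarrow> bool" where
  "hash_tables K t B \<longleftrightarrow>
     (\<forall>k<K. (\<forall>j\<in>addresses t. finite (B k j)) \<and> disjoint_family_on (B k) (addresses t))"

definition elements_at_distance ::
    "nat \<Rightarrow> (nat \<Rightarrow> bool list \<Rightarrow> 'e set) \<Rightarrow> nat \<Rightarrow> bool list \<Rightarrow> nat \<Rightarrow> 'e set" where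
  "elements_at_distance t B k i d = (\<Union>j\<in>{j \<in> addresses t. hamming i j = d}. B k j)"

definition counts ::
    "nat \<Rightarrow> (nat \<Rightarrow> bool list \<Rightarrow> 'e set) \<Rightarrow> nat \<Rightarrow> bool list \<Rightarrow> nat \<Rightarrow> nat \<Rightarrow> int" where
  "counts t B k i s a =
     int (card (\<Union>j\<in>{j \<in> addresses t. hamming i j = s \<and> take a j = take a i}. B k j))"

text \<open>Programs are pieces of syntax that do not depend on the number of tables, on the address
  length or on the contents of the tables. They work on integer registers, an integer-indexed
  memory of integers, and one output register for an element. The tables can be accessed only
  through \<open>Size\<close> (number of elements of a bucket) and \<open>Select\<close> (a uniformly random element of a
  bucket). \<open>For\<close> evaluates its bound once, on entry. There is no unbounded loop, so every program
  terminates; this only restricts the algorithms whose existence can be claimed.\<close>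

datatype aexp =
    N int
  | V string
  | Load aexp
  | Size aexp aexp
  | Plus aexp aexp
  | Minus aexp aexp
  | Times aexp aexp
  | Div aexp aexp
  | Mod aexp aexp

datatype bexp = Less aexp aexp | Eq aexp aexp

datatype com =
    Skip
  | Assign string aexp
  | Store aexp aexp
  | Seq com com
  | Cond bexp com com
  | For string aexp com
  | Flip string aexp aexp
  | Select aexp aexp

record 'e state =
  var :: "string \<Rightarrow> int"
  mem :: "int \<Rightarrow> int"
  out :: "'e option"
  clock :: nat

primrec aval :: "(int \<Rightarrow> int \<Rightarrow> 'e set) \<Rightarrow> 'e state \<Rightarrow> aexp \<Rightarrow> int" where
  "aval bk \<sigma> (N n) = n"
| "aval bk \<sigma> (V x) = var \<sigma> x"
| "aval bk \<sigma> (Load e) = mem \<sigma> (aval bk \<sigma> e)"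
| "aval bk \<sigma> (Size e f) = int (card (bk (aval bk \<sigma> e) (aval bk \<sigma> f)))"
| "aval bk \<sigma> (Plus e f) = aval bk \<sigma> e + aval bk \<sigma> f"
| "aval bk \<sigma> (Minus e f) = aval bk \<sigma> e - aval bk \<sigma> f"
| "aval bk \<sigma> (Times e f) = aval bk \<sigma> e * aval bk \<sigma> f"
| "aval bk \<sigma> (Div e f) = aval bk \<sigma> e div aval bk \<sigma> f"
| "aval bk \<sigma> (Mod e f) = aval bk \<sigma> e mod aval bk \<sigma> f"

primrec acost :: "aexp \<Rightarrow> nat" where
  "acost (N n) = 1"
| "acost (V x) = 1"
| "acost (Load e) = 1 + acost e"
| "acost (Size e f) = 1 + acost e + acost f"
| "acost (Plus e f) = 1 + acost e + acost f"
| "acost (Minus e f) = 1 + acost e + acost f"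
| "acost (Times e f) = 1 + acost e + acost f"
| "acost (Div e f) = 1 + acost e + acost f"
| "acost (Mod e f) = 1 + acost e + acost f"

primrec bval :: "(int \<Rightarrow> int \<Rightarrow> 'e set) \<Rightarrow> 'e state \<Rightarrow> bexp \<Rightarrow> bool" where
  "bval bk \<sigma> (Less e f) \<longleftrightarrow> aval bk \<sigma> e < aval bk \<sigma> f"
| "bval bk \<sigma> (Eq e f) \<longleftrightarrow> aval bk \<sigma> e = aval bk \<sigma> f"

primrec bcost :: "bexp \<Rightarrow> nat" where
  "bcost (Less e f) = 1 + acost e + acost f"
| "bcost (Eq e f) = 1 + acost e + acost f"

definition tick :: "nat \<Rightarrow> 'e state \<Rightarrow> 'e state" where
  "tick n \<sigma> = \<sigma>\<lparr>clock := clock \<sigma> + n\<rparr>"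

definition set_var :: "string \<Rightarrow> int \<Rightarrow> 'e state \<Rightarrow> 'e state" where
  "set_var x n \<sigma> = \<sigma>\<lparr>var := (var \<sigma>)(x := n)\<rparr>"

primrec iterate :: "(nat \<Rightarrow> 'e state \<Rightarrow> 'e state pmf) \<Rightarrow> nat \<Rightarrow> 'e state \<Rightarrow> 'e state pmf" where
  "iterate f 0 \<sigma> = return_pmf \<sigma>"
| "iterate f (Suc n) \<sigma> = bind_pmf (iterate f n \<sigma>) (f n)"

text \<open>\<open>Flip x e f\<close> sets \<open>x\<close> to 1 with probability \<open>e / f\<close> (clamped to the unit interval) and to 0
  otherwise. \<open>Select\<close> on an empty bucket delivers no element.\<close>

primrec exec :: "(int \<Rightarrow> int \<Rightarrow> 'e set) \<Rightarrow> com \<Rightarrow> 'e state \<Rightarrow> 'e state pmf" where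
  "exec bk Skip = (\<lambda>\<sigma>. return_pmf (tick 1 \<sigma>))"
| "exec bk (Assign x e) = (\<lambda>\<sigma>. return_pmf (tick (1 + acost e) (set_var x (aval bk \<sigma> e) \<sigma>)))"
| "exec bk (Store e f) = (\<lambda>\<sigma>. return_pmf (tick (1 + acost e + acost f)
     (\<sigma>\<lparr>mem := (mem \<sigma>)(aval bk \<sigma> e := aval bk \<sigma> f)\<rparr>)))"
| "exec bk (Seq c d) = (\<lambda>\<sigma>. bind_pmf (exec bk c \<sigma>) (exec bk d))"
| "exec bk (Cond b c d) = (\<lambda>\<sigma>. (if bval bk \<sigma> b then exec bk c else exec bk d)
     (tick (1 + bcost b) \<sigma>))"
| "exec bk (For x e c) = (\<lambda>\<sigma>. iterate (\<lambda>n \<sigma>'. exec bk c (tick 1 (set_var x (int n) \<sigma>')))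
     (nat (aval bk \<sigma> e)) (tick (1 + acost e) \<sigma>))"
| "exec bk (Flip x e f) = (\<lambda>\<sigma>. map_pmf
     (\<lambda>b. tick (1 + acost e + acost f) (set_var x (of_bool b) \<sigma>))
     (bernoulli_pmf (real_of_int (aval bk \<sigma> e) / real_of_int (aval bk \<sigma> f))))"
| "exec bk (Select e f) = (\<lambda>\<sigma>. map_pmf
     (\<lambda>z. tick (1 + acost e + acost f) (\<sigma>\<lparr>out := z\<rparr>))
     (let S = bk (aval bk \<sigma> e) (aval bk \<sigma> f)
      in if S = {} then return_pmf None else map_pmf Some (pmf_of_set S)))"

text \<open>In the machine an address is the integer whose binary digits are the bits of the address,
  the first bit being the least significant one.\<close>

definition code :: "bool list \<Rightarrow> int" where
  "code i = horner_sum of_bool 2 i"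

definition bucket_at :: "nat \<Rightarrow> nat \<Rightarrow> (nat \<Rightarrow> bool list \<Rightarrow> 'e set) \<Rightarrow> int \<Rightarrow> int \<Rightarrow> 'e set" where
  "bucket_at K t B k x =
     (if 0 \<le> k \<and> k < int K \<and> 0 \<le> x \<and> x < 2 ^ t then B (nat k) (map (bit x) [0..<t]) else {})"

lemma map_bit_code: "i \<in> addresses t \<Longrightarrow> map (bit (code i)) [0..<t] = i"
  by (rule nth_equalityI) (auto simp: addresses_def code_def bit_horner_sum_bit_iff)

text \<open>The counts matrices are stored one after the other, each of them row by row.\<close>

definition location :: "nat \<Rightarrow> nat \<Rightarrow> bool list \<Rightarrow> nat \<Rightarrow> nat \<Rightarrow> int" where
  "location t k i s a =
     ((int k * 2 ^ t + code i) * (int t + 1) + int s) * (int t + 1) + int a"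

definition stores_counts ::
    "nat \<Rightarrow> nat \<Rightarrow> (nat \<Rightarrow> bool list \<Rightarrow> 'e set) \<Rightarrow> (int \<Rightarrow> int) \<Rightarrow> bool" where
  "stores_counts K t B m \<longleftrightarrow>
     (\<forall>k<K. \<forall>i\<in>addresses t. \<forall>s\<le>t. \<forall>a\<le>t. m (location t k i s a) = counts t B k i s a)"

end

theory Submission
  imports Defs
begin

text \<open>Let \<open>i'\<close> be \<open>i\<close> with bit \<open>a\<close> flipped. The elements at distance \<open>s\<close> from \<open>i\<close> that agree with
  \<open>i\<close> on the first \<open>a\<close> bits either agree on bit \<open>a\<close> as well, or they agree with \<open>i'\<close> on the first
  \<open>a + 1\<close> bits and are at distance \<open>s - 1\<close> from \<open>i'\<close>. Hence
  \<open>M\<^sub>i[s, a] = M\<^sub>i[s, a + 1] + M\<^sub>i\<^sub>'[s - 1, a + 1]\<close>, and filling the columns from \<open>a = t\<close> downwards costs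
  constant time per entry. The sampler follows the same splitting from \<open>a = 0\<close> to \<open>a = t\<close>, choosing
  each part with probability proportional to its number of elements. The uniform distribution on the
  current set is a martingale of this walk, which gives exact uniformity.\<close>

section \<open>The recurrence for the counts\<close>

text \<open>Decodes every integer, using only its lowest \<open>t\<close> bits. The quotient of a
  row number by \<open>t + 1\<close> can thus be decoded while it still carries the table number in
  its higher bits.\<close>

definition address :: "nat \<Rightarrow> int \<Rightarrow> bool list" where
  "address t x = map (bit x) [0..<t]"

definition prefix_elements ::
    "nat \<Rightarrow> (bool list \<Rightarrow> 'e set) \<Rightarrow> bool list \<Rightarrow> nat \<Rightarrow> nat \<Rightarrow> 'e set" where
  "prefix_elements t b i s a = (\<Union>j\<in>{j \<in> addresses t. hamming i j = s \<and> take a j = take a i}. b j)"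

section \<open>Hamming distance and agreement of prefixes\<close>

lemma finite_addresses: "finite (addresses t)"
  using finite_lists_length_eq[of "UNIV :: bool set" t] by (simp add: addresses_def)

lemma hamming_eq_0_iff: "length i = length j \<Longrightarrow> hamming i j = 0 \<longleftrightarrow> i = j"
  by (auto simp: hamming_def list_eq_iff_nth_eq)

text \<open>The flipped address agrees with \<open>j\<close> at position \<open>a\<close>, so
  exactly that position leaves the set of disagreements.\<close>

lemma hamming_flip:
  assumes "a < length i" "j ! a \<noteq> i ! a"
  shows "hamming i j = Suc (hamming (i[a := \<not> i ! a]) j)"
proof -
  have "{r. r < length i \<and> i ! r \<noteq> j ! r}
      = insert a {r. r < length i \<and> i[a := \<not> i ! a] ! r \<noteq> j ! r}"
    using assms by (auto simp: nth_list_update split: if_splits)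
  with assms show ?thesis
    by (simp add: hamming_def)
qed

lemma finite_prefix_elements:
  assumes "\<forall>j\<in>addresses t. finite (b j)"
  shows "finite (prefix_elements t b i s a)"
  using assms finite_addresses[of t] by (auto simp: prefix_elements_def)

lemma prefix_elements_last:
  assumes "i \<in> addresses t"
  shows "prefix_elements t b i s t = (if s = 0 then b i else {})"
proof -
  have "{j \<in> addresses t. hamming i j = s \<and> take t j = take t i} = (if s = 0 then {i} else {})"
    using assms hamming_eq_0_iff[of i i] by (auto simp: addresses_def)
  then show ?thesis
    by (simp add: prefix_elements_def)
qed

lemma take_Suc_eq_iff:
  assumes "length i = length j" "a < length i"
  shows "take (Suc a) j = take (Suc a) i \<longleftrightarrow> take a j = take a i \<and> j ! a = i ! a"
  using assms by (simp add: take_Suc_conv_app_nth)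

text \<open>Case distinction on whether \<open>j\<close> agrees with \<open>i\<close> at bit
  \<open>a\<close>. Writing \<open>s = Suc ...\<close> instead of a subtraction makes the second
  part empty for \<open>s = 0\<close>.\<close>

lemma addresses_prefix_split:
  assumes "i \<in> addresses t" "a < t"
  shows "{j \<in> addresses t. hamming i j = s \<and> take a j = take a i} =
    {j \<in> addresses t. hamming i j = s \<and> take (Suc a) j = take (Suc a) i} \<union>
    {j \<in> addresses t. s = Suc (hamming (i[a := \<not> i ! a]) j) \<and>
       take (Suc a) j = take (Suc a) (i[a := \<not> i ! a])}" (is "?L = ?R")
proof (intro set_eqI)
  fix j
  show "j \<in> ?L \<longleftrightarrow> j \<in> ?R"
    using assms hamming_flip[of a i j]
    by (cases "j ! a = i ! a") (auto simp: take_Suc_eq_iff addresses_def)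
qed

lemma prefix_elements_0:
  assumes "i \<in> addresses t" "a < t"
  shows "prefix_elements t b i 0 a = prefix_elements t b i 0 (Suc a)"
  unfolding prefix_elements_def by (subst addresses_prefix_split[OF assms]) simp

lemma prefix_elements_Suc:
  assumes "i \<in> addresses t" "a < t"
  shows "prefix_elements t b i (Suc s) a =
    prefix_elements t b i (Suc s) (Suc a) \<union> prefix_elements t b (i[a := \<not> i ! a]) s (Suc a)"
  unfolding prefix_elements_def
  by (subst addresses_prefix_split[OF assms]) (auto simp: eq_commute)

text \<open>The addresses on the two sides differ at bit \<open>a\<close>, whatever their distances,
  so no bucket is shared, and different buckets are disjoint.\<close>

lemma prefix_elements_flip_disjoint:
  assumes "i \<in> addresses t" "a < t" "disjoint_family_on b (addresses t)"
  shows "prefix_elements t b i s (Suc a) \<inter> prefix_elements t b (i[a := \<not> i ! a]) s' (Suc a) = {}"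
proof -
  have "j \<noteq> j'" if "length j = t" "length j' = t" "take (Suc a) j = take (Suc a) i"
      "take (Suc a) j' = take (Suc a) (i[a := \<not> i ! a])" for j j'
    using that assms(1,2) by (auto simp: take_Suc_eq_iff addresses_def)
  then show ?thesis
    using assms(3) by (fastforce simp: prefix_elements_def addresses_def disjoint_family_on_def)
qed

section \<open>Addresses as integers\<close>

lemma address_in_addresses [simp]: "address t x \<in> addresses t"
  by (simp add: address_def addresses_def)

lemma address_flip_bit:
  "a < t \<Longrightarrow> address t (flip_bit a x) = (address t x)[a := \<not> address t x ! a]"
  by (rule nth_equalityI) (auto simp: address_def bit_flip_bit_iff nth_list_update)

lemma address_mod: "address t (x mod 2 ^ t) = address t x"
  by (simp add: address_def bit_take_bit_iff flip: take_bit_eq_mod)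

text \<open>Table numbers sit above the \<open>t\<close> address bits, so flipping an address bit
  does not change the table.\<close>

lemma flip_bit_div:
  fixes x :: int
  assumes "a < t"
  shows "flip_bit a x div 2 ^ t = x div 2 ^ t"
proof -
  have "drop_bit t (flip_bit a x) = drop_bit t x"
    using assms by (auto intro!: bit_eqI simp: bit_drop_bit_eq bit_flip_bit_iff)
  then show ?thesis
    by (simp add: drop_bit_eq_div)
qed

text \<open>The machine has no bit operations. The last factor is 1 for a cleared and -1 for a set
  bit, so \<open>2 ^ a\<close> is added or subtracted accordingly.\<close>

lemma flip_bit_arith:
  fixes x :: int
  shows "flip_bit a x = x + 2 ^ a * (1 - 2 * (x div 2 ^ a mod 2))"
  by (auto simp: flip_bit_eq_if set_bit_eq unset_bit_eq bit_iff_odd mod_2_eq_odd)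

lemma code_bounds:
  assumes "i \<in> addresses t"
  shows "0 \<le> code i \<and> code i < 2 ^ t"
proof -
  have "take_bit t (code i) = code i"
    using assms by (auto intro!: bit_eqI simp: addresses_def code_def bit_take_bit_iff bit_horner_sum_bit_iff)
  then show ?thesis
    by (metis take_bit_nonnegative take_bit_int_less_exp)
qed

lemma code_address: "code (address t x) = x mod 2 ^ t"
  by (simp add: code_def address_def horner_sum_bit_eq_take_bit take_bit_eq_mod)

section \<open>Row numbers and the recurrence on rows\<close>

text \<open>A matrix row is identified with its position in memory, in units of \<open>t + 1\<close> cells, so that
  table, address and distance are recovered from it by division.\<close>

definition count_row :: "nat \<Rightarrow> nat \<Rightarrow> bool list \<Rightarrow> nat \<Rightarrow> int" where
  "count_row t k i s = (int k * 2 ^ t + code i) * (int t + 1) + int s"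

definition row_elements ::
    "nat \<Rightarrow> (nat \<Rightarrow> bool list \<Rightarrow> 'e set) \<Rightarrow> int \<Rightarrow> nat \<Rightarrow> 'e set" where
  "row_elements t B r a =
     prefix_elements t (B (nat (r div (int t + 1) div 2 ^ t))) (address t (r div (int t + 1)))
       (nat (r mod (int t + 1))) a"

text \<open>Meaningless if \<open>r mod (t + 1) = 0\<close>: there is no distance below 0, and the result belongs to
  a different matrix.\<close>

definition flipped_row :: "nat \<Rightarrow> nat \<Rightarrow> int \<Rightarrow> int" where
  "flipped_row t a r = flip_bit a (r div (int t + 1)) * (int t + 1) + r mod (int t + 1) - 1"

definition count_rows :: "nat \<Rightarrow> nat \<Rightarrow> int set" where
  "count_rows K t = {0..<int K * 2 ^ t * (int t + 1)}"

lemma int_div_less_iff: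
  fixes c :: int
  assumes "0 < c"
  shows "r div c < k \<longleftrightarrow> r < k * c"
proof
  assume "r div c < k"
  then have "(r div c + 1) * c \<le> k * c"
    using assms by (intro mult_right_mono) auto
  then show "r < k * c"
    using div_mult_mod_eq[of r c] pos_mod_bound[OF assms, of r] unfolding distrib_right by linarith
next
  assume "r < k * c"
  then have "r div c * c < k * c"
    using div_mult_mod_eq[of r c] pos_mod_sign[OF assms, of r] by linarith
  then show "r div c < k"
    using assms by simp
qed

text \<open>Address and distance are remainders and always in range, so only the table number is
  constrained.\<close>

lemma count_rows_iff:
  "r \<in> count_rows K t \<longleftrightarrow> 0 \<le> r div (int t + 1) div 2 ^ t \<and> r div (int t + 1) div 2 ^ t < int K"
proof -
  have "r < int K * 2 ^ t * (int t + 1) \<longleftrightarrow> r div (int t + 1) div 2 ^ t < int K"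
    by (simp add: int_div_less_iff ac_simps flip: zdiv_zmult2_eq)
  then show ?thesis
    by (simp add: count_rows_def pos_imp_zdiv_nonneg_iff)
qed

lemma count_row_div_mod:
  assumes "i \<in> addresses t" "s \<le> t"
  shows "count_row t k i s div (int t + 1) = int k * 2 ^ t + code i"
    and "count_row t k i s mod (int t + 1) = int s"
  using assms by (simp_all add: count_row_def)

lemma row_elements_count_row:
  assumes "i \<in> addresses t" "s \<le> t"
  shows "row_elements t B (count_row t k i s) a = prefix_elements t (B k) i s a"
proof -
  have "address t (int k * 2 ^ t + code i) = address t (code i)"
    by (metis address_mod mod_mult_self3)
  also have "\<dots> = i"
    using assms(1) map_bit_code by (simp add: address_def)
  finally show ?thesis
    using assms code_bounds[OF assms(1)]
    by (simp add: row_elements_def count_row_div_mod)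
qed

lemma count_row_in_count_rows:
  assumes "i \<in> addresses t" "s \<le> t" "k < K"
  shows "count_row t k i s \<in> count_rows K t"
  using assms code_bounds[OF assms(1)] by (simp add: count_rows_iff count_row_div_mod)

lemma count_rowE:
  assumes "r \<in> count_rows K t"
  obtains k i s where "k < K" "i \<in> addresses t" "s \<le> t" "r = count_row t k i s"
proof
  let ?x = "r div (int t + 1)"
  show "nat (?x div 2 ^ t) < K" "address t ?x \<in> addresses t"
    using assms by (auto simp: count_rows_iff)
  show "nat (r mod (int t + 1)) \<le> t"
    using pos_mod_bound[of "int t + 1" r] by linarith
  have "int (nat (?x div 2 ^ t)) = ?x div 2 ^ t" "int (nat (r mod (int t + 1))) = r mod (int t + 1)"
    using assms by (simp_all add: count_rows_iff)
  then show "r = count_row t (nat (?x div 2 ^ t)) (address t ?x) (nat (r mod (int t + 1)))"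
    by (simp only: count_row_def code_address div_mult_mod_eq)
qed

text \<open>Replaces the quantifiers over tables, addresses and distances by one over an interval of
  row numbers, which a single loop can traverse. By \<open>count_rowE\<close> the matrix rows
  exhaust this interval.\<close>

lemma stores_counts_iff:
  "stores_counts K t B m \<longleftrightarrow>
    (\<forall>r\<in>count_rows K t. \<forall>a\<le>t. m (r * (int t + 1) + int a) = int (card (row_elements t B r a)))"
proof -
  have eq: "counts t B k i s a = int (card (row_elements t B (count_row t k i s) a))"
    "location t k i s a = count_row t k i s * (int t + 1) + int a" if "i \<in> addresses t" "s \<le> t" for k i s a
    using that by (simp add: row_elements_count_row counts_def prefix_elements_def)
      (simp add: location_def count_row_def)
  show ?thesis
  proof
    assume "stores_counts K t B m"
    then show "\<forall>r\<in>count_rows K t. \<forall>a\<le>t. m (r * (int t + 1) + int a) = int (card (row_elements t B r a))"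
      unfolding stores_counts_def by (metis eq count_rowE)
  next
    assume "\<forall>r\<in>count_rows K t. \<forall>a\<le>t. m (r * (int t + 1) + int a) = int (card (row_elements t B r a))"
    then show "stores_counts K t B m"
      unfolding stores_counts_def by (simp add: eq count_row_in_count_rows)
  qed
qed

lemma finite_row_elements:
  assumes "hash_tables K t B" "r \<in> count_rows K t"
  shows "finite (row_elements t B r a)"
  using assms unfolding row_elements_def
  by (intro finite_prefix_elements) (auto simp: hash_tables_def count_rows_iff)

text \<open>Full agreement forces distance 0 and leaves a single bucket, named here by the quotient
  and remainder that the programs pass to \<open>Size\<close> and \<open>Select\<close>.\<close>

lemma row_elements_last:
  assumes "r \<in> count_rows K t"
  shows "row_elements t B r t = (if r mod (int t + 1) = 0
    then bucket_at K t B (r div (int t + 1) div 2 ^ t) (r div (int t + 1) mod 2 ^ t) else {})"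
proof -
  have "bucket_at K t B (r div (int t + 1) div 2 ^ t) (r div (int t + 1) mod 2 ^ t) =
      B (nat (r div (int t + 1) div 2 ^ t)) (address t (r div (int t + 1)))"
    using assms by (simp add: bucket_at_def count_rows_iff address_mod flip: address_def)
  moreover have "nat (r mod (int t + 1)) = 0 \<longleftrightarrow> r mod (int t + 1) = 0"
    using pos_mod_sign[of "int t + 1" r] by linarith
  ultimately show ?thesis
    by (simp add: row_elements_def prefix_elements_last)
qed

lemma row_elements_step_0:
  assumes "r mod (int t + 1) = 0" "a < t"
  shows "row_elements t B r a = row_elements t B r (Suc a)"
  using assms by (simp add: row_elements_def prefix_elements_0)

context
  fixes t a :: nat and r :: int
  assumes r: "r mod (int t + 1) \<noteq> 0" and a: "a < t"
begin

lemma flipped_row_div_mod: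
  "flipped_row t a r div (int t + 1) = flip_bit a (r div (int t + 1))"
  "flipped_row t a r mod (int t + 1) = r mod (int t + 1) - 1"
proof -
  let ?f = "flip_bit a (r div (int t + 1))"
  have eq: "flipped_row t a r = ?f * (int t + 1) + (r mod (int t + 1) - 1)"
    by (simp add: flipped_row_def)
  \<comment> \<open>A positive distance stays a valid remainder after subtracting 1, so nothing is
    borrowed from the address.\<close>
  have m: "0 \<le> r mod (int t + 1) - 1" "r mod (int t + 1) - 1 < int t + 1"
    using r pos_mod_bound[of "int t + 1" r] pos_mod_sign[of "int t + 1" r] by linarith+
  show "flipped_row t a r div (int t + 1) = ?f"
    unfolding eq using m by (subst div_mult_self3) auto
  show "flipped_row t a r mod (int t + 1) = r mod (int t + 1) - 1"
    unfolding eq using m by (subst mod_mult_self3) auto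
qed

lemma flipped_row_in_count_rows: "r \<in> count_rows K t \<Longrightarrow> flipped_row t a r \<in> count_rows K t"
  using a by (simp add: count_rows_iff flipped_row_div_mod flip_bit_div)

lemma row_elements_flipped_row:
  "row_elements t B (flipped_row t a r) a' =
    prefix_elements t (B (nat (r div (int t + 1) div 2 ^ t)))
      ((address t (r div (int t + 1)))[a := \<not> address t (r div (int t + 1)) ! a])
      (nat (r mod (int t + 1)) - 1) a'"
proof -
  have "nat (r mod (int t + 1) - 1) = nat (r mod (int t + 1)) - 1"
    by linarith
  then show ?thesis
    using a by (simp add: row_elements_def flipped_row_div_mod flip_bit_div address_flip_bit)
qed

lemma row_elements_step:
  "row_elements t B r a =
    row_elements t B r (Suc a) \<union> row_elements t B (flipped_row t a r) (Suc a)"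
proof -
  have "0 \<le> r mod (int t + 1)"
    by simp
  then obtain s where "nat (r mod (int t + 1)) = Suc s"
    using r by (metis gr0_implies_Suc nat_0_iff neq0_conv order_antisym)
  then show ?thesis
    using a unfolding row_elements_flipped_row by (simp add: row_elements_def prefix_elements_Suc)
qed

lemma row_elements_flipped_disjoint:
  assumes "hash_tables K t B" "r \<in> count_rows K t"
  shows "row_elements t B r (Suc a) \<inter> row_elements t B (flipped_row t a r) (Suc a) = {}"
proof -
  have "disjoint_family_on (B (nat (r div (int t + 1) div 2 ^ t))) (addresses t)"
    using assms by (auto simp: hash_tables_def count_rows_iff)
  then have "prefix_elements t (B (nat (r div (int t + 1) div 2 ^ t))) (address t (r div (int t + 1))) s (Suc a) \<inter>
     prefix_elements t (B (nat (r div (int t + 1) div 2 ^ t))) ((address t (r div (int t + 1)))[a := \<not> address t (r div (int t + 1)) ! a]) s' (Suc a) = {}" for s s'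
    using a by (intro prefix_elements_flip_disjoint) auto
  then show ?thesis
    unfolding row_elements_flipped_row by (simp add: row_elements_def)
qed

lemma card_row_elements_step:
  assumes "hash_tables K t B" "r \<in> count_rows K t"
  shows "card (row_elements t B r a) =
    card (row_elements t B r (Suc a)) + card (row_elements t B (flipped_row t a r) (Suc a))"
  unfolding row_elements_step
  using assms flipped_row_in_count_rows finite_row_elements row_elements_flipped_disjoint
  by (metis card_Un_disjoint)

end

text \<open>Column numbers are smaller than the width \<open>t + 1\<close>, so division recovers the
  row. Hence a write to one cell leaves all other entries intact.\<close>

lemma cell_eq_iff:
  assumes "a \<le> t" "a' \<le> t"
  shows "r * (int t + 1) + int a = r' * (int t + 1) + int a' \<longleftrightarrow> r = r' \<and> a = a'"
proof
  assume eq: "r * (int t + 1) + int a = r' * (int t + 1) + int a'"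
  have "(r * (int t + 1) + int a) div (int t + 1) = r" "(r' * (int t + 1) + int a') div (int t + 1) = r'"
    using assms by simp_all
  then have "r = r'"
    using eq by simp
  with eq show "r = r' \<and> a = a'"
    by simp
qed simp

section \<open>Reasoning about loops\<close>

lemma state_simps [simp]:
  "var (tick n \<sigma>) = var \<sigma>" "mem (tick n \<sigma>) = mem \<sigma>" "out (tick n \<sigma>) = out \<sigma>"
  "clock (tick n \<sigma>) = clock \<sigma> + n"
  "var (set_var x m \<sigma>) = (var \<sigma>)(x := m)" "mem (set_var x m \<sigma>) = mem \<sigma>"
  "out (set_var x m \<sigma>) = out \<sigma>" "clock (set_var x m \<sigma>) = clock \<sigma>"
  by (simp_all add: tick_def set_var_def)

lemma iterate_invariant:
  assumes "I 0 \<sigma>"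
    and "\<And>n \<sigma> \<sigma>'. n < m \<Longrightarrow> I n \<sigma> \<Longrightarrow> \<sigma>' \<in> set_pmf (f n \<sigma>) \<Longrightarrow> I (Suc n) \<sigma>'"
    and "\<sigma>' \<in> set_pmf (iterate f m \<sigma>)"
  shows "I m \<sigma>'"
  using assms(2,3)
proof (induction m arbitrary: \<sigma>')
  case 0
  then show ?case
    using assms(1) by simp
next
  case (Suc m)
  from Suc.prems(2) obtain \<tau> where \<tau>: "\<tau> \<in> set_pmf (iterate f m \<sigma>)" "\<sigma>' \<in> set_pmf (f m \<tau>)"
    by auto
  have "I m \<tau>"
    using Suc.prems(1) \<tau>(1) by (intro Suc.IH) auto
  then show ?case
    using Suc.prems(1) \<tau>(2) by blast
qed

text \<open>Think of \<open>h n\<close> as the law of the final answer given the state after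
  \<open>n\<close> rounds. If each round preserves it on average, so does the whole loop, by
  associativity of \<open>bind_pmf\<close>.\<close>

lemma iterate_martingale:
  assumes "I 0 \<sigma>"
    and "\<And>n \<sigma> \<sigma>'. n < m \<Longrightarrow> I n \<sigma> \<Longrightarrow> \<sigma>' \<in> set_pmf (f n \<sigma>) \<Longrightarrow> I (Suc n) \<sigma>'"
    and "\<And>n \<sigma>. n < m \<Longrightarrow> I n \<sigma> \<Longrightarrow> bind_pmf (f n \<sigma>) (h (Suc n)) = h n \<sigma>"
  shows "bind_pmf (iterate f m \<sigma>) (h m) = h 0 \<sigma>"
  using assms(2,3)
proof (induction m)
  case 0
  then show ?case
    by (simp add: bind_return_pmf)
next
  case (Suc m)
  have "I m \<tau>" if "\<tau> \<in> set_pmf (iterate f m \<sigma>)" for \<tau>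
    by (rule iterate_invariant[of I, OF assms(1) _ that]) (use Suc.prems(1) in auto)
  then have "bind_pmf (iterate f (Suc m) \<sigma>) (h (Suc m)) = bind_pmf (iterate f m \<sigma>) (h m)"
    using Suc.prems(2) by (auto simp: bind_assoc_pmf intro!: bind_pmf_cong)
  also have "\<dots> = h 0 \<sigma>"
    using Suc.prems by (intro Suc.IH) auto
  finally show ?case .
qed

section \<open>The programs\<close>

definition power_com :: com where
  "power_com = Seq (Assign ''P'' (N 1)) (For ''n'' (V ''t'') (Assign ''P'' (Times (V ''P'') (N 2))))"

abbreviation width :: aexp where
  "width \<equiv> Plus (V ''t'') (N 1)"

abbreviation address_code :: aexp where
  "address_code \<equiv> Div (V ''r'') width"

abbreviation cell :: "aexp \<Rightarrow> aexp" where
  "cell a \<equiv> Plus (Times (V ''r'') width) a"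

text \<open>\<open>flipped_row\<close> in machine arithmetic, for the bit \<open>a\<close> with
  \<open>P\<close> equal to \<open>2 ^ a\<close>: the product moves the address part, the final
  subtraction lowers the distance.\<close>

abbreviation neighbour :: aexp where
  "neighbour \<equiv> Minus (Plus (V ''r'') (Times (Times (V ''P'')
     (Minus (N 1) (Times (N 2) (Mod (Div address_code (V ''P'')) (N 2))))) width)) (N 1)"

definition last_column_com :: com where
  "last_column_com = Cond (Eq (Mod (V ''r'') width) (N 0))
     (Store (cell (V ''t'')) (Size (Div address_code (V ''P'')) (Mod address_code (V ''P''))))
     (Store (cell (V ''t'')) (N 0))"

text \<open>Round \<open>n\<close> computes column \<open>t - n - 1\<close> from column
  \<open>t - n\<close>. A row at distance 0 is copied, because its flipped part is empty and
  \<open>neighbour\<close> is meaningless there.\<close>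

definition column_com :: com where
  "column_com = Cond (Eq (Mod (V ''r'') width) (N 0))
     (Store (cell (Minus (Minus (V ''t'') (V ''n'')) (N 1))) (Load (cell (Minus (V ''t'') (V ''n'')))))
     (Store (cell (Minus (Minus (V ''t'') (V ''n'')) (N 1)))
       (Plus (Load (cell (Minus (V ''t'') (V ''n''))))
         (Load (Plus (Times neighbour width) (Minus (V ''t'') (V ''n''))))))"

text \<open>Halving \<open>P\<close> before each column keeps it equal to \<open>2 ^ a\<close> for
  the column \<open>a\<close> being written. There are \<open>t + 1\<close> columns of
  \<open>K * 2 ^ t * (t + 1)\<close> rows each, at constant cost per entry.\<close>

definition precompute_com :: com where
  "precompute_com = Seq power_com (Seq (Assign ''R'' (Times (Times (V ''K'') (V ''P'')) width))
     (Seq (For ''r'' (V ''R'') last_column_com)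
       (For ''n'' (V ''t'') (Seq (Assign ''P'' (Div (V ''P'') (N 2))) (For ''r'' (V ''R'') column_com)))))"

text \<open>The number of elements reached by flipping is computed as a difference within the current row,
  which is 0 at distance 0, where \<open>neighbour\<close> is meaningless.\<close>

definition walk_com :: com where
  "walk_com = Seq (Flip ''b'' (Minus (Load (cell (V ''n''))) (Load (cell (Plus (V ''n'') (N 1)))))
       (Load (cell (V ''n''))))
     (Seq (Cond (Eq (V ''b'') (N 1)) (Assign ''r'' neighbour) Skip)
       (Assign ''P'' (Times (V ''P'') (N 2))))"

text \<open>\<open>P\<close> is needed as \<open>2 ^ t\<close> for the initial row, then as
  \<open>2 ^ n\<close> in round \<open>n\<close> of the walk. After the last round it is
  \<open>2 ^ t\<close> again, as the final division into table and address requires.\<close>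

definition sample_com :: com where
  "sample_com = Seq power_com
     (Seq (Assign ''r'' (Plus (Times (Plus (Times (V ''k'') (V ''P'')) (V ''i'')) width) (V ''d'')))
       (Seq (Assign ''P'' (N 1))
         (Seq (For ''n'' (V ''t'') walk_com)
           (Select (Div address_code (V ''P'')) (Mod address_code (V ''P''))))))"

section \<open>Correctness and running time\<close>

lemma exec_power_com:
  assumes "\<sigma>' \<in> set_pmf (exec bk power_com \<sigma>)" "var \<sigma> ''t'' = int t"
  shows "var \<sigma>' ''P'' = 2 ^ t" "\<And>x. x \<noteq> ''P'' \<Longrightarrow> x \<noteq> ''n'' \<Longrightarrow> var \<sigma>' x = var \<sigma> x"
    "mem \<sigma>' = mem \<sigma>" "clock \<sigma>' \<le> clock \<sigma> + 4 + 5 * t"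
proof -
  define I where "I n \<tau> \<longleftrightarrow> var \<tau> ''P'' = 2 ^ n \<and> (\<forall>x. x \<noteq> ''P'' \<and> x \<noteq> ''n'' \<longrightarrow> var \<tau> x = var \<sigma> x) \<and>
    mem \<tau> = mem \<sigma> \<and> clock \<tau> \<le> clock \<sigma> + 4 + 5 * n" for n and \<tau> :: "'a state"
  let ?f = "\<lambda>n \<tau>. exec bk (Assign ''P'' (Times (V ''P'') (N 2))) (tick 1 (set_var ''n'' (int n) \<tau>))"
  let ?\<sigma> = "tick 2 (tick 2 (set_var ''P'' 1 \<sigma>))"
  have "\<sigma>' \<in> set_pmf (iterate ?f t ?\<sigma>)"
    using assms by (simp add: power_com_def bind_return_pmf numeral_2_eq_2)
  then have "I t \<sigma>'"
    by (rule iterate_invariant[rotated 2]) (auto simp: I_def)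
  then show "var \<sigma>' ''P'' = 2 ^ t" "\<And>x. x \<noteq> ''P'' \<Longrightarrow> x \<noteq> ''n'' \<Longrightarrow> var \<sigma>' x = var \<sigma> x"
    "mem \<sigma>' = mem \<sigma>" "clock \<sigma>' \<le> clock \<sigma> + 4 + 5 * t"
    by (auto simp: I_def)
qed

lemma exec_last_column_com:
  assumes "r \<in> count_rows K t" "var \<sigma> ''t'' = int t" "var \<sigma> ''P'' = 2 ^ t" "var \<sigma> ''r'' = r"
    and "\<sigma>' \<in> set_pmf (exec (bucket_at K t B) last_column_com \<sigma>)"
  shows "var \<sigma>' = var \<sigma>"
    "mem \<sigma>' = (mem \<sigma>)(r * (int t + 1) + int t := int (card (row_elements t B r t)))"
    "clock \<sigma>' \<le> clock \<sigma> + 40"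
  using assms by (auto simp: last_column_com_def row_elements_last split: if_splits)

lemma flipped_row_arith:
  "flipped_row t a r =
    r + 2 ^ a * (1 - 2 * (r div (int t + 1) div 2 ^ a mod 2)) * (int t + 1) - 1"
  using div_mult_mod_eq[of r "int t + 1"]
  by (simp add: flipped_row_def flip_bit_arith distrib_right)

text \<open>The whole column \<open>t - n\<close> is assumed, since the flipped row can precede or
  follow the current one.\<close>

lemma exec_column_com:
  assumes "hash_tables K t B" "r \<in> count_rows K t" "n < t"
    and "var \<sigma> ''t'' = int t" "var \<sigma> ''n'' = int n" "var \<sigma> ''P'' = 2 ^ (t - Suc n)" "var \<sigma> ''r'' = r"
    and mem: "\<forall>r\<in>count_rows K t. mem \<sigma> (r * (int t + 1) + int (t - n)) = int (card (row_elements t B r (t - n)))"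
    and "\<sigma>' \<in> set_pmf (exec (bucket_at K t B) column_com \<sigma>)"
  shows "var \<sigma>' = var \<sigma> \<and>
    mem \<sigma>' = (mem \<sigma>)(r * (int t + 1) + int (t - Suc n) := int (card (row_elements t B r (t - Suc n)))) \<and>
    clock \<sigma>' \<le> clock \<sigma> + 80"
proof -
  \<comment> \<open>The machine subtracts integers; \<open>n < t\<close> makes its column numbers
    agree with the natural ones.\<close>
  have diff: "int t - int n = int (t - n)" "int (t - n) - 1 = int (t - Suc n)" "Suc (t - Suc n) = t - n"
    using assms(3) by auto
  show ?thesis
  proof (cases "r mod (int t + 1) = 0")
    case True
    then show ?thesis
      using assms row_elements_step_0[of r t "t - Suc n" B]
      by (auto simp: column_com_def diff simp del: of_nat_diff)
  next
    case False
    then show ?thesis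
      using assms card_row_elements_step[OF False, of "t - Suc n" K B]
        flipped_row_in_count_rows[OF False, of "t - Suc n" K]
      by (auto simp: column_com_def diff simp flip: flipped_row_arith simp del: of_nat_diff)
  qed
qed

text \<open>A part drawn with weight proportional to its size gives each of its elements probability
  1 over the size of the union. An empty part has weight 0 and is never drawn, which later keeps the
  walk on nonempty sets.\<close>

lemma mixture_pmf_of_set:
  fixes f :: "bool \<Rightarrow> 'a set"
  assumes "finite (f True)" "finite (f False)" "f True \<inter> f False = {}" "f True \<union> f False \<noteq> {}"
    and p: "p = card (f True) / card (f True \<union> f False)"
  shows "bind_pmf (bernoulli_pmf p) (\<lambda>b. pmf_of_set (f b)) = pmf_of_set (f True \<union> f False)"
    and "b \<in> set_pmf (bernoulli_pmf p) \<Longrightarrow> f b \<noteq> {}"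
proof -
  have card: "card (f True \<union> f False) = card (f True) + card (f False)"
    using assms by (intro card_Un_disjoint) auto
  have pos: "card (f True) + card (f False) > 0"
    using assms by (auto simp: card_gt_0_iff)
  then have "real (card (f True)) + real (card (f False)) \<noteq> 0"
    by linarith
  then have p01: "0 \<le> p" "p \<le> 1" and q: "1 - p = card (f False) / card (f True \<union> f False)"
    by (simp_all add: p card divide_simps)
  show ne: "f b \<noteq> {}" if "b \<in> set_pmf (bernoulli_pmf p)" for b
    using that p01 q pos by (cases b) (auto simp: set_pmf_iff p)
  show "bind_pmf (bernoulli_pmf p) (\<lambda>b. pmf_of_set (f b)) = pmf_of_set (f True \<union> f False)"
  proof (rule pmf_eqI)
    fix x
    \<comment> \<open>\<open>pmf_of_set\<close> is unspecified on the empty set, but then the factor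
      \<open>p\<close> is 0.\<close>
    have "pmf (pmf_of_set (f True)) x * p = indicator (f True) x / card (f True \<union> f False)"
      using assms(1) by (cases "f True = {}") (auto simp: p)
    moreover have "pmf (pmf_of_set (f False)) x * (1 - p) = indicator (f False) x / card (f True \<union> f False)"
      using assms(2) by (cases "f False = {}") (auto simp: q)
    ultimately show "pmf (bind_pmf (bernoulli_pmf p) (\<lambda>b. pmf_of_set (f b))) x =
        pmf (pmf_of_set (f True \<union> f False)) x"
      using assms(1-4) p01 by (auto simp: pmf_bind indicator_def simp flip: add_divide_distrib)
  qed
qed


section \<open>Precomputation of all columns\<close>

lemma exec_precompute_com:
  assumes hash: "hash_tables K t B" and \<sigma>: "clock \<sigma> = 0" "var \<sigma> ''K'' = int K" "var \<sigma> ''t'' = int t"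
    and \<sigma>': "\<sigma>' \<in> set_pmf (exec (bucket_at K t B) precompute_com \<sigma>)"
  shows "stores_counts K t B (mem \<sigma>')"
    and "clock \<sigma>' \<le> 20 + 20 * t + 50 * (K * 2 ^ t * (t + 1)) + t * (90 * (K * 2 ^ t * (t + 1)))"
proof -
  define R where "R = K * 2 ^ t * (t + 1)"
  have rows: "count_rows K t = {0..<int R}"
    by (simp add: count_rows_def R_def algebra_simps)
  let ?bk = "bucket_at K t B"
  define column where "column m a X \<longleftrightarrow>
    (\<forall>r\<in>X. m (r * (int t + 1) + int a) = int (card (row_elements t B r a)))" for m a X
  \<comment> \<open>Writing a correct value does no damage: other columns keep their cells by
    \<open>cell_eq_iff\<close>, and the column written to gains row \<open>r\<close>.\<close>
  have column_upd: "column (m(r * (int t + 1) + int a := int (card (row_elements t B r a)))) a' X'"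
    if "column m a' X" "a \<le> t" "a' \<le> t" "a' = a \<Longrightarrow> X' \<subseteq> insert r X" "a' \<noteq> a \<Longrightarrow> X' \<subseteq> X" for m r a a' X X'
    using that by (cases "a' = a") (auto simp: column_def cell_eq_iff)
  \<comment> \<open>After \<open>n\<close> rounds the columns from \<open>t - n\<close> to
    \<open>t\<close> are complete. The constants are rounded up: a row costs at most 1 + 80, the
    start of a round 7.\<close>
  define J where "J n \<tau> \<longleftrightarrow> var \<tau> ''t'' = int t \<and> var \<tau> ''R'' = int R \<and> var \<tau> ''P'' = 2 ^ (t - n) \<and>
      (\<forall>a\<le>t. t - n \<le> a \<longrightarrow> column (mem \<tau>) a (count_rows K t)) \<and>
      clock \<tau> \<le> 20 + 5 * t + 50 * R + n * (10 + 90 * R)" for n and \<tau> :: "'a state"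
  from \<sigma>' obtain \<tau>1 where \<tau>1: "\<tau>1 \<in> set_pmf (exec ?bk power_com \<sigma>)" and
    \<sigma>'1: "\<sigma>' \<in> set_pmf (exec ?bk (Seq (Assign ''R'' (Times (Times (V ''K'') (V ''P'')) width))
     (Seq (For ''r'' (V ''R'') last_column_com)
       (For ''n'' (V ''t'') (Seq (Assign ''P'' (Div (V ''P'') (N 2))) (For ''r'' (V ''R'') column_com))))) \<tau>1)"
    unfolding precompute_com_def by auto
  note power = exec_power_com[OF \<tau>1 \<sigma>(3)]
  define \<tau>2 where "\<tau>2 = tick 8 (set_var ''R'' (int R) \<tau>1)"
  have \<tau>2: "var \<tau>2 ''t'' = int t" "var \<tau>2 ''R'' = int R" "var \<tau>2 ''P'' = 2 ^ t" "clock \<tau>2 \<le> 12 + 5 * t"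
    using power \<sigma> by (auto simp: \<tau>2_def)
  have "int K * 2 ^ t * (int t + 1) = int R"
    by (simp add: R_def distrib_left)
  then obtain \<tau>3 where \<tau>3: "\<tau>3 \<in> set_pmf (exec ?bk (For ''r'' (V ''R'') last_column_com) \<tau>2)" and
    \<sigma>'3: "\<sigma>' \<in> set_pmf (exec ?bk (For ''n'' (V ''t'')
       (Seq (Assign ''P'' (Div (V ''P'') (N 2))) (For ''r'' (V ''R'') column_com))) \<tau>3)"
    using \<sigma>'1 power(1,2) \<sigma>(2,3) by (auto simp: bind_return_pmf \<tau>2_def eval_nat_numeral simp del: exec.simps(6))
  have J0: "J 0 (tick 2 \<tau>3)"
  proof -
    define I where "I n \<tau> \<longleftrightarrow> var \<tau> ''t'' = int t \<and> var \<tau> ''R'' = int R \<and> var \<tau> ''P'' = 2 ^ t \<and>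
      column (mem \<tau>) t {0..<int n} \<and> clock \<tau> \<le> 15 + 5 * t + 50 * n" for n and \<tau> :: "'a state"
    have "I R \<tau>3"
    proof (rule iterate_invariant)
      show "I 0 (tick 2 \<tau>2)"
        using \<tau>2 by (simp add: I_def column_def)
      show "\<tau>3 \<in> set_pmf (iterate (\<lambda>n \<tau>. exec ?bk last_column_com (tick 1 (set_var ''r'' (int n) \<tau>))) R (tick 2 \<tau>2))"
        using \<tau>3 \<tau>2 by (simp add: numeral_2_eq_2)
      fix n \<tau> \<tau>'
      assume n: "n < R" and I: "I n \<tau>" and
        \<tau>': "\<tau>' \<in> set_pmf (exec ?bk last_column_com (tick 1 (set_var ''r'' (int n) \<tau>)))"
      have "var \<tau>' = var (tick 1 (set_var ''r'' (int n) \<tau>))"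
        "mem \<tau>' = (mem (tick 1 (set_var ''r'' (int n) \<tau>)))
          (int n * (int t + 1) + int t := int (card (row_elements t B (int n) t)))"
        "clock \<tau>' \<le> clock (tick 1 (set_var ''r'' (int n) \<tau>)) + 40"
        by (rule exec_last_column_com[OF _ _ _ _ \<tau>']; use n I in \<open>simp add: I_def rows\<close>)+
      then show "I (Suc n) \<tau>'"
        using I by (auto simp: I_def intro!: column_upd[where X = "{0..<int n}"])
    qed
    then show ?thesis
      by (auto simp: I_def J_def rows)
  qed
  have "J t \<sigma>'"
  proof (rule iterate_invariant)
    let ?f = "\<lambda>n \<tau>. exec ?bk (Seq (Assign ''P'' (Div (V ''P'') (N 2))) (For ''r'' (V ''R'') column_com))
      (tick 1 (set_var ''n'' (int n) \<tau>))"
    show "J 0 (tick 2 \<tau>3)"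
      by (rule J0)
    show "\<sigma>' \<in> set_pmf (iterate ?f t (tick 2 \<tau>3))"
      using \<sigma>'3 J0 by (simp add: J_def numeral_2_eq_2)
    fix n \<tau> \<tau>'
    assume n: "n < t" and J: "J n \<tau>" and \<tau>': "\<tau>' \<in> set_pmf (?f n \<tau>)"
    define \<tau>0 where "\<tau>0 = tick 2 (tick 4 (set_var ''P'' (2 ^ (t - Suc n)) (tick 1 (set_var ''n'' (int n) \<tau>))))"
    \<comment> \<open>The inner invariant keeps the finished columns and adds column
      \<open>t - Suc n\<close> for the rows below \<open>l\<close>; at \<open>l = R\<close> these
      are all rows.\<close>
    define I where "I l \<upsilon> \<longleftrightarrow> var \<upsilon> ''t'' = int t \<and> var \<upsilon> ''R'' = int R \<and> var \<upsilon> ''P'' = 2 ^ (t - Suc n) \<and>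
      var \<upsilon> ''n'' = int n \<and> (\<forall>a\<le>t. t - n \<le> a \<longrightarrow> column (mem \<upsilon>) a (count_rows K t)) \<and>
      column (mem \<upsilon>) (t - Suc n) {0..<int l} \<and>
      clock \<upsilon> \<le> 20 + 5 * t + 50 * R + n * (10 + 90 * R) + 10 + 90 * l" for l and \<upsilon> :: "'a state"
    have "I R \<tau>'"
    proof (rule iterate_invariant)
      show "I 0 \<tau>0"
        using J by (simp add: I_def J_def column_def \<tau>0_def)
      have "(2::int) ^ (t - n) div 2 = 2 ^ (t - Suc n)"
        using n by (subst Suc_diff_Suc[symmetric]) auto
      then show "\<tau>' \<in> set_pmf (iterate (\<lambda>n \<tau>. exec ?bk column_com (tick 1 (set_var ''r'' (int n) \<tau>))) R \<tau>0)"
        using \<tau>' J by (simp add: J_def \<tau>0_def bind_return_pmf eval_nat_numeral)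
      fix l \<upsilon> \<upsilon>'
      assume l: "l < R" and I: "I l \<upsilon>" and
        \<upsilon>': "\<upsilon>' \<in> set_pmf (exec ?bk column_com (tick 1 (set_var ''r'' (int l) \<upsilon>)))"
      have "var \<upsilon>' = var (tick 1 (set_var ''r'' (int l) \<upsilon>)) \<and>
        mem \<upsilon>' = (mem (tick 1 (set_var ''r'' (int l) \<upsilon>)))
          (int l * (int t + 1) + int (t - Suc n) := int (card (row_elements t B (int l) (t - Suc n)))) \<and>
        clock \<upsilon>' \<le> clock (tick 1 (set_var ''r'' (int l) \<upsilon>)) + 80"
        by (rule exec_column_com[OF hash _ n _ _ _ _ _ \<upsilon>']) (use l I in \<open>auto simp: I_def rows column_def\<close>)
      moreover have "column ((mem \<upsilon>)(int l * (int t + 1) + int (t - Suc n) :=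
          int (card (row_elements t B (int l) (t - Suc n))))) a (count_rows K t)" if "a \<le> t" "t - n \<le> a" for a
        by (rule column_upd[where X = "count_rows K t"]) (use I that n in \<open>auto simp: I_def\<close>)
      moreover have "column ((mem \<upsilon>)(int l * (int t + 1) + int (t - Suc n) :=
          int (card (row_elements t B (int l) (t - Suc n))))) (t - Suc n) {0..<int (Suc l)}"
        by (rule column_upd[where X = "{0..<int l}"]) (use I in \<open>auto simp: I_def\<close>)
      ultimately show "I (Suc l) \<upsilon>'"
        using I by (auto simp: I_def)
    qed
    moreover have "t - Suc n \<le> a \<Longrightarrow> a = t - Suc n \<or> t - n \<le> a" for a
      by linarith
    ultimately show "J (Suc n) \<tau>'"
      by (auto simp: I_def J_def rows)
  qed
  then show "stores_counts K t B (mem \<sigma>')"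
    by (simp add: J_def stores_counts_iff column_def)
  show "clock \<sigma>' \<le> 20 + 20 * t + 50 * (K * 2 ^ t * (t + 1)) + t * (90 * (K * 2 ^ t * (t + 1)))"
    using \<open>J t \<sigma>'\<close> unfolding J_def R_def[symmetric] by (simp add: distrib_left)
qed


section \<open>The random walk\<close>

lemma exec_walk_move:
  assumes "var \<sigma> ''t'' = int t" "var \<sigma> ''P'' = 2 ^ n" "var \<sigma> ''r'' = r"
  shows "\<exists>\<tau>. exec bk (Seq (Cond (Eq (V ''b'') (N 1)) (Assign ''r'' neighbour) Skip)
       (Assign ''P'' (Times (V ''P'') (N 2)))) \<sigma> = return_pmf \<tau> \<and>
     var \<tau> ''r'' = (if var \<sigma> ''b'' = 1 then flipped_row t n r else r) \<and>
     var \<tau> ''t'' = int t \<and> var \<tau> ''P'' = 2 ^ Suc n \<and> mem \<tau> = mem \<sigma> \<and> clock \<tau> \<le> clock \<sigma> + 50"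
  using assms by (cases "var \<sigma> ''b'' = 1") (simp_all add: bind_return_pmf flipped_row_arith)

text \<open>The first claim is the martingale equation for one step, the second the invariant for
  every possible outcome.\<close>

lemma exec_walk_com:
  assumes hash: "hash_tables K t B" and r: "r \<in> count_rows K t" "row_elements t B r n \<noteq> {}" and n: "n < t"
    and \<sigma>: "var \<sigma> ''t'' = int t" "var \<sigma> ''n'' = int n" "var \<sigma> ''P'' = 2 ^ n" "var \<sigma> ''r'' = r"
      "stores_counts K t B (mem \<sigma>)"
  shows "bind_pmf (exec bk walk_com \<sigma>) (\<lambda>\<tau>. pmf_of_set (row_elements t B (var \<tau> ''r'') (Suc n))) =
      pmf_of_set (row_elements t B r n)"
    and "\<sigma>' \<in> set_pmf (exec bk walk_com \<sigma>) \<Longrightarrow>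
      var \<sigma>' ''r'' \<in> count_rows K t \<and> row_elements t B (var \<sigma>' ''r'') (Suc n) \<noteq> {} \<and>
      var \<sigma>' ''t'' = int t \<and> var \<sigma>' ''P'' = 2 ^ Suc n \<and> mem \<sigma>' = mem \<sigma> \<and> clock \<sigma>' \<le> clock \<sigma> + 80"
proof -
  \<comment> \<open>\<open>f True\<close> is the part reached by flipping, \<open>f False\<close>
    the part kept. At distance 0 the former is empty by definition, since \<open>flipped_row\<close>
    is meaningless there.\<close>
  define f where "f b = (if \<not> b then row_elements t B r (Suc n)
    else if r mod (int t + 1) = 0 then {} else row_elements t B (flipped_row t n r) (Suc n))" for b
  define p where "p = real (card (f True)) / real (card (f True \<union> f False))"
  have f_Un: "f True \<union> f False = row_elements t B r n"
    using n row_elements_step[of r t n B] row_elements_step_0[of r t n B] by (auto simp: f_def)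
  have f_disj: "f True \<inter> f False = {}"
    using n row_elements_flipped_disjoint[OF _ n hash r(1)] by (auto simp: f_def)
  have f_fin: "finite (f b)" for b
    using f_Un finite_row_elements[OF hash r(1), of n] by (cases b) (auto dest: arg_cong[of _ _ finite])
  have "card (f True \<union> f False) = card (f True) + card (f False)"
    using f_fin f_disj by (intro card_Un_disjoint)
  then have card: "real (card (row_elements t B r n)) - real (card (row_elements t B r (Suc n))) = real (card (f True))"
    unfolding f_Un by (simp add: f_def)
  note mix = mixture_pmf_of_set[of f p, OF f_fin f_fin f_disj _ p_def]
  have mem: "mem \<sigma> (r * (int t + 1) + int a) = int (card (row_elements t B r a))" if "a \<le> t" for a
    using \<sigma>(5) r(1) that by (simp add: stores_counts_iff)
  from mem[of "Suc n"] n have mem_Suc: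
    "mem \<sigma> (r * (int t + 1) + (int n + 1)) = int (card (row_elements t B r (Suc n)))"
    by (simp add: add_ac)
  let ?rest = "Seq (Cond (Eq (V ''b'') (N 1)) (Assign ''r'' neighbour) Skip) (Assign ''P'' (Times (V ''P'') (N 2)))"
  let ?e = "Minus (Load (cell (V ''n''))) (Load (cell (Plus (V ''n'') (N 1))))"
  let ?f = "Load (cell (V ''n''))"
  let ?\<sigma> = "\<lambda>b. tick (1 + acost ?e + acost ?f) (set_var ''b'' (of_bool b) \<sigma>)"
  \<comment> \<open>After the coin the step is deterministic, so its result is a function of the
    coin alone. The 28 is the cost of the \<open>Flip\<close>.\<close>
  have "\<forall>b. \<exists>\<tau>. exec bk ?rest (?\<sigma> b) = return_pmf \<tau> \<and>
     var \<tau> ''r'' = (if b then flipped_row t n r else r) \<and>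
     var \<tau> ''t'' = int t \<and> var \<tau> ''P'' = 2 ^ Suc n \<and> mem \<tau> = mem \<sigma> \<and> clock \<tau> \<le> clock \<sigma> + 28 + 50"
  proof
    fix b
    show "\<exists>\<tau>. exec bk ?rest (?\<sigma> b) = return_pmf \<tau> \<and>
     var \<tau> ''r'' = (if b then flipped_row t n r else r) \<and>
     var \<tau> ''t'' = int t \<and> var \<tau> ''P'' = 2 ^ Suc n \<and> mem \<tau> = mem \<sigma> \<and> clock \<tau> \<le> clock \<sigma> + 28 + 50"
      using exec_walk_move[of "?\<sigma> b" t n r bk] \<sigma> by (simp del: exec.simps)
  qed
  then obtain \<tau> where \<tau>: "\<And>b. exec bk ?rest (?\<sigma> b) = return_pmf (\<tau> b)"
    "\<And>b. var (\<tau> b) ''r'' = (if b then flipped_row t n r else r)"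
    "\<And>b. var (\<tau> b) ''t'' = int t \<and> var (\<tau> b) ''P'' = 2 ^ Suc n \<and> mem (\<tau> b) = mem \<sigma> \<and> clock (\<tau> b) \<le> clock \<sigma> + 28 + 50"
    by metis
  have exec: "exec bk walk_com \<sigma> = map_pmf \<tau> (bernoulli_pmf p)"
  proof -
    have p: "p = real_of_int (aval bk \<sigma> ?e) / real_of_int (aval bk \<sigma> ?f)"
      using \<sigma> mem[of n] mem_Suc n card by (simp add: p_def f_Un)
    have "exec bk walk_com \<sigma> = bind_pmf (bernoulli_pmf p) (\<lambda>b. exec bk ?rest (?\<sigma> b))"
      unfolding p by (simp only: walk_com_def exec.simps(4,7) bind_map_pmf)
    then show ?thesis
      by (simp only: \<tau>(1) map_pmf_def)
  qed
  \<comment> \<open>An outcome of positive probability has a nonempty part. This excludes flipping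
    at distance 0, so the row reached is genuine.\<close>
  have support: "f b = row_elements t B (var (\<tau> b) ''r'') (Suc n) \<and>
      row_elements t B (var (\<tau> b) ''r'') (Suc n) \<noteq> {} \<and> var (\<tau> b) ''r'' \<in> count_rows K t"
    if b: "b \<in> set_pmf (bernoulli_pmf p)" for b
  proof -
    have ne: "f b \<noteq> {}"
      using f_Un r(2) by (intro mix(2)[OF _ b]) simp
    show ?thesis
    proof (cases b)
      case True
      then have "r mod (int t + 1) \<noteq> 0"
        using ne by (auto simp: f_def)
      then show ?thesis
        using True ne flipped_row_in_count_rows[OF _ n r(1)] by (simp add: f_def \<tau>(2))
    next
      case False
      then show ?thesis
        using ne r(1) by (simp add: f_def \<tau>(2))
    qed
  qed
  show "bind_pmf (exec bk walk_com \<sigma>) (\<lambda>\<tau>. pmf_of_set (row_elements t B (var \<tau> ''r'') (Suc n))) =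
      pmf_of_set (row_elements t B r n)"
  proof -
    have "bind_pmf (exec bk walk_com \<sigma>) (\<lambda>\<tau>. pmf_of_set (row_elements t B (var \<tau> ''r'') (Suc n))) =
      bind_pmf (bernoulli_pmf p) (\<lambda>b. pmf_of_set (f b))"
      unfolding exec bind_map_pmf using support by (intro bind_pmf_cong) simp_all
    then show ?thesis
      using mix(1) r(2) by (simp add: f_Un)
  qed
  assume "\<sigma>' \<in> set_pmf (exec bk walk_com \<sigma>)"
  then obtain b where b: "b \<in> set_pmf (bernoulli_pmf p)" and \<sigma>': "\<sigma>' = \<tau> b"
    unfolding exec by auto
  show "var \<sigma>' ''r'' \<in> count_rows K t \<and> row_elements t B (var \<sigma>' ''r'') (Suc n) \<noteq> {} \<and>
      var \<sigma>' ''t'' = int t \<and> var \<sigma>' ''P'' = 2 ^ Suc n \<and> mem \<sigma>' = mem \<sigma> \<and> clock \<sigma>' \<le> clock \<sigma> + 80"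
    using support[OF b] \<tau>(3)[of b] unfolding \<sigma>' by simp
qed

lemma exec_sample_com:
  assumes hash: "hash_tables K t B" and k: "k < K" and i: "i \<in> addresses t" and d: "d \<le> t"
    and ne: "elements_at_distance t B k i d \<noteq> {}"
    and \<sigma>: "clock \<sigma> = 0" "stores_counts K t B (mem \<sigma>)" "var \<sigma> ''t'' = int t" "var \<sigma> ''k'' = int k"
      "var \<sigma> ''i'' = code i" "var \<sigma> ''d'' = int d"
  shows "map_pmf out (exec (bucket_at K t B) sample_com \<sigma>) =
      map_pmf Some (pmf_of_set (elements_at_distance t B k i d))"
    and "\<sigma>' \<in> set_pmf (exec (bucket_at K t B) sample_com \<sigma>) \<Longrightarrow>
      stores_counts K t B (mem \<sigma>') \<and> clock \<sigma>' \<le> 60 + 90 * t"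
proof -
  let ?bk = "bucket_at K t B"
  define r where "r = count_row t k i d"
  have r: "r \<in> count_rows K t" "row_elements t B r 0 = elements_at_distance t B k i d"
    using i d k by (simp_all add: r_def count_row_in_count_rows row_elements_count_row
      prefix_elements_def elements_at_distance_def)
  define I where "I n \<tau> \<longleftrightarrow> var \<tau> ''r'' \<in> count_rows K t \<and> row_elements t B (var \<tau> ''r'') n \<noteq> {} \<and>
      var \<tau> ''t'' = int t \<and> var \<tau> ''P'' = 2 ^ n \<and> stores_counts K t B (mem \<tau>) \<and>
      clock \<tau> \<le> 40 + 5 * t + 85 * n" for n and \<tau> :: "'a state"
  \<comment> \<open>The martingale: the uniform distribution on the elements still
    reachable.\<close>
  define h where "h n \<tau> = pmf_of_set (row_elements t B (var \<tau> ''r'') n)" for n and \<tau> :: "'a state"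
  let ?f = "\<lambda>n \<tau>. exec ?bk walk_com (tick 1 (set_var ''n'' (int n) \<tau>))"
  let ?select = "Select (Div address_code (V ''P'')) (Mod address_code (V ''P''))"
  define start where "start \<tau> = tick 2 (tick 2 (set_var ''P'' 1 (tick 12 (set_var ''r'' r \<tau>))))" for \<tau> :: "'a state"
  have exec: "exec ?bk sample_com \<sigma> = bind_pmf (exec ?bk power_com \<sigma>)
    (\<lambda>\<tau>. bind_pmf (iterate ?f t (start \<tau>)) (exec ?bk ?select))"
    unfolding sample_com_def exec.simps(4)
  proof (rule bind_pmf_cong[OF refl])
    fix \<tau> assume "\<tau> \<in> set_pmf (exec ?bk power_com \<sigma>)"
    note power = exec_power_com[OF this \<sigma>(3)]
    show "bind_pmf (exec ?bk (Assign ''r'' (Plus (Times (Plus (Times (V ''k'') (V ''P'')) (V ''i'')) width) (V ''d''))) \<tau>)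
       (\<lambda>\<tau>. bind_pmf (exec ?bk (Assign ''P'' (N 1)) \<tau>)
         (\<lambda>\<tau>. bind_pmf (exec ?bk (For ''n'' (V ''t'') walk_com) \<tau>) (exec ?bk ?select))) =
      bind_pmf (iterate ?f t (start \<tau>)) (exec ?bk ?select)"
      using power(1,2) \<sigma> by (simp add: bind_return_pmf start_def r_def count_row_def eval_nat_numeral del: exec.simps(8))
  qed
  have start: "I 0 (start \<tau>)" "var (start \<tau>) ''r'' = r" if "\<tau> \<in> set_pmf (exec ?bk power_com \<sigma>)" for \<tau>
    using exec_power_com[OF that \<sigma>(3)] \<sigma> r ne by (auto simp: I_def start_def)
  have step: "I (Suc n) \<tau>'" if "n < t" "I n \<tau>" "\<tau>' \<in> set_pmf (?f n \<tau>)" for n \<tau> \<tau>'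
    using that exec_walk_com(2)[OF hash, of "var \<tau> ''r''" n "tick 1 (set_var ''n'' (int n) \<tau>)" \<tau>' ?bk]
    by (auto simp: I_def)
  have martingale: "bind_pmf (?f n \<tau>) (h (Suc n)) = h n \<tau>" if "n < t" "I n \<tau>" for n \<tau>
    unfolding h_def
    using that exec_walk_com(1)[OF hash, of "var \<tau> ''r''" n "tick 1 (set_var ''n'' (int n) \<tau>)" ?bk]
    by (auto simp: I_def)
  have final: "I t \<upsilon>" if "\<tau> \<in> set_pmf (exec ?bk power_com \<sigma>)" "\<upsilon> \<in> set_pmf (iterate ?f t (start \<tau>))" for \<tau> \<upsilon>
    by (rule iterate_invariant[of I, OF start(1)[OF that(1)] step that(2)])
  \<comment> \<open>In column \<open>t\<close> a row at positive distance has no elements. The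
    invariant excludes this, so the walk ends at distance 0 and the current set is the bucket from
    which \<open>Select\<close> draws.\<close>
  have select: "map_pmf out (exec ?bk ?select \<upsilon>) = map_pmf Some (h t \<upsilon>)" if "I t \<upsilon>" for \<upsilon>
    using that row_elements_last[of "var \<upsilon> ''r''" K t B]
    by (auto simp: I_def h_def pmf.map_comp o_def split: if_splits)
  have "map_pmf out (exec ?bk sample_com \<sigma>) = bind_pmf (exec ?bk power_com \<sigma>)
      (\<lambda>\<tau>. map_pmf Some (bind_pmf (iterate ?f t (start \<tau>)) (h t)))"
    unfolding exec map_bind_pmf
    by (intro bind_pmf_cong refl select final)
  also have "\<dots> = bind_pmf (exec ?bk power_com \<sigma>)
      (\<lambda>\<tau>. map_pmf Some (pmf_of_set (elements_at_distance t B k i d)))"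
  proof (intro bind_pmf_cong refl)
    fix \<tau> assume \<tau>: "\<tau> \<in> set_pmf (exec ?bk power_com \<sigma>)"
    \<comment> \<open>The martingale carries the final uniform draw back to the initial one, on all
      elements at distance \<open>d\<close>. This law is the same for every state left by
      \<open>power_com\<close>, so the outer bind becomes constant.\<close>
    have "bind_pmf (iterate ?f t (start \<tau>)) (h t) = h 0 (start \<tau>)"
      by (rule iterate_martingale[of I _ t ?f h, OF start(1)[OF \<tau>] step martingale])
    then show "map_pmf Some (bind_pmf (iterate ?f t (start \<tau>)) (h t)) =
        map_pmf Some (pmf_of_set (elements_at_distance t B k i d))"
      by (simp add: h_def start(2)[OF \<tau>] r(2))
  qed
  finally show "map_pmf out (exec ?bk sample_com \<sigma>) =
      map_pmf Some (pmf_of_set (elements_at_distance t B k i d))"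
    by simp
  show "stores_counts K t B (mem \<sigma>') \<and> clock \<sigma>' \<le> 60 + 90 * t"
    if \<sigma>0: "\<sigma>' \<in> set_pmf (exec ?bk sample_com \<sigma>)"
  proof -
    obtain \<tau> \<upsilon> where "\<tau> \<in> set_pmf (exec ?bk power_com \<sigma>)" "\<upsilon> \<in> set_pmf (iterate ?f t (start \<tau>))"
      and \<sigma>': "\<sigma>' \<in> set_pmf (exec ?bk ?select \<upsilon>)"
      using \<sigma>0 unfolding exec set_bind_pmf by blast
    then have "I t \<upsilon>"
      using final by blast
    then show ?thesis
      using \<sigma>' by (auto simp: I_def)
  qed
qed

theorem theorem4:
  shows "\<exists>(precompute :: com) (sample :: com) (C :: nat).
    \<forall>(K :: nat) (t :: nat) (B :: nat \<Rightarrow> bool list \<Rightarrow> 'e set). hash_tables K t B \<longrightarrow>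
      (\<forall>\<sigma> :: 'e state. clock \<sigma> = 0 \<and> var \<sigma> ''K'' = int K \<and> var \<sigma> ''t'' = int t \<longrightarrow>
        (\<forall>\<sigma>' \<in> set_pmf (exec (bucket_at K t B) precompute \<sigma>).
          stores_counts K t B (mem \<sigma>') \<and>
          (0 < K \<and> 0 < t \<longrightarrow> clock \<sigma>' \<le> C * (K * t ^ 3 * 2 ^ t)))) \<and>
      (\<forall>k<K. \<forall>i\<in>addresses t. \<forall>d\<le>t. elements_at_distance t B k i d \<noteq> {} \<longrightarrow>
        (\<forall>\<sigma> :: 'e state. clock \<sigma> = 0 \<and> stores_counts K t B (mem \<sigma>) \<and>
            var \<sigma> ''t'' = int t \<and> var \<sigma> ''k'' = int k \<and> var \<sigma> ''i'' = code i \<and>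
            var \<sigma> ''d'' = int d \<longrightarrow>
          map_pmf out (exec (bucket_at K t B) sample \<sigma>) =
            map_pmf Some (pmf_of_set (elements_at_distance t B k i d)) \<and>
          (\<forall>\<sigma>' \<in> set_pmf (exec (bucket_at K t B) sample \<sigma>).
            stores_counts K t B (mem \<sigma>') \<and> (0 < t \<longrightarrow> clock \<sigma>' \<le> C * t))))"
proof -
  have precompute_time: "20 + 20 * t + 50 * (K * 2 ^ t * (t + 1)) + t * (90 * (K * 2 ^ t * (t + 1)))
      \<le> 320 * (K * t ^ 3 * 2 ^ t)" if "0 < K" "0 < t" for K t :: nat
  proof -
    \<comment> \<open>The expanded bound has the monomials 1, \<open>t\<close>, \<open>X\<close>,
      \<open>X * t\<close> and \<open>X * t ^ 2\<close>, each at most \<open>X * t ^ 3\<close>; 320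
      is the sum of their coefficients 20, 20, 50, 140 and 90.\<close>
    define X where "X = K * 2 ^ t"
    have X: "1 \<le> X" "1 \<le> t ^ 3" "t \<le> t ^ 3" "t ^ 2 \<le> t ^ 3"
      using that by (simp_all add: X_def power_increasing self_le_power)
    then have "1 * 1 \<le> X * t ^ 3" "1 * t \<le> X * t ^ 3" "X * 1 \<le> X * t ^ 3" "X * t \<le> X * t ^ 3" "X * t ^ 2 \<le> X * t ^ 3"
      by (simp_all only: mult_le_mono order_refl)
    moreover have "20 + 20 * t + 50 * (X * (t + 1)) + t * (90 * (X * (t + 1))) =
        20 + 20 * t + 50 * X + 140 * (X * t) + 90 * (X * t ^ 2)"
      by (simp add: algebra_simps power2_eq_square)
    ultimately have "20 + 20 * t + 50 * (X * (t + 1)) + t * (90 * (X * (t + 1))) \<le> 320 * (X * t ^ 3)"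
      by linarith
    then show ?thesis
      by (simp add: X_def mult_ac)
  qed
  show ?thesis
  proof (rule exI[of _ precompute_com], rule exI[of _ sample_com], rule exI[of _ 320],
      intro allI impI conjI ballI)
    fix K t :: nat and B :: "nat \<Rightarrow> bool list \<Rightarrow> 'e set" and \<sigma> \<sigma>' :: "'e state"
    assume hash: "hash_tables K t B" and \<sigma>: "clock \<sigma> = 0 \<and> var \<sigma> ''K'' = int K \<and> var \<sigma> ''t'' = int t"
      and \<sigma>': "\<sigma>' \<in> set_pmf (exec (bucket_at K t B) precompute_com \<sigma>)"
    show "stores_counts K t B (mem \<sigma>')"
      using exec_precompute_com(1)[OF hash _ _ _ \<sigma>'] \<sigma> by simp
    assume "0 < K \<and> 0 < t"
    then show "clock \<sigma>' \<le> 320 * (K * t ^ 3 * 2 ^ t)"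
      using order_trans[OF exec_precompute_com(2)[OF hash _ _ _ \<sigma>'] precompute_time] \<sigma> by simp
  next
    fix K t k d :: nat and B :: "nat \<Rightarrow> bool list \<Rightarrow> 'e set" and i and \<sigma> :: "'e state"
    assume "hash_tables K t B" "k < K" "i \<in> addresses t" "d \<le> t" "elements_at_distance t B k i d \<noteq> {}"
      and \<sigma>: "clock \<sigma> = 0 \<and> stores_counts K t B (mem \<sigma>) \<and>
            var \<sigma> ''t'' = int t \<and> var \<sigma> ''k'' = int k \<and> var \<sigma> ''i'' = code i \<and> var \<sigma> ''d'' = int d"
    note sample = exec_sample_com[OF this(1-5), of \<sigma>]
    show "map_pmf out (exec (bucket_at K t B) sample_com \<sigma>) =
        map_pmf Some (pmf_of_set (elements_at_distance t B k i d))"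
      using sample(1) \<sigma> by simp
    fix \<sigma>'
    assume "\<sigma>' \<in> set_pmf (exec (bucket_at K t B) sample_com \<sigma>)"
    then have \<sigma>': "stores_counts K t B (mem \<sigma>') \<and> clock \<sigma>' \<le> 60 + 90 * t"
      using sample(2) \<sigma> by simp
    then show "stores_counts K t B (mem \<sigma>')" ..
    \<comment> \<open>For positive \<open>t\<close> the bound \<open>60 + 90 * t\<close> is at most
      \<open>150 * t\<close>, so the constant 320 serves the sampler as well.\<close>
    assume "0 < t"
    with \<sigma>' show "clock \<sigma>' \<le> 320 * t"
      by simp
  qed
qed

end
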